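(* For every finite simple graph $G$, the following statements are equivalent: (1) $G$ is a threshold graph; (2) the clique hypergraph $\mathcal{C}(G)$ is $1$-Sperner; (3) the clique hypergraph $\mathcal{C}(G)$ is threshold; (4) the clique hypergraph $\mathcal{C}(G)$ is $2$-asummable.
   Context: A hypergraph $\mathcal{H}=(V,E)$ consists of a finite vertex set $V$ and a set $E$ of subsets of $V$ (hyperedges). $\mathcal{H}$ is $1$-Sperner if every two distinct hyperedges $e,f$ satisfy $\min\{|e\setminus f|,|f\setminus e|\}=1$. A set $X\subseteq V$ is independent in $\mathcal{H}$ if it contains no hyperedge, and dependent otherwise. $\mathcal{H}$ is threshold if there exist $w:V\to\mathbb{Z}_{\ge0}$ and $t\in\mathbb{Z}_{\ge0}$ such that for every $X\subseteq V$, $\sum_{x\in X}w(x)\ge t$ if and only if $X$ contains some hyperedge. $\mathcal{H}$ is $2$-asummable if there are no (not necessarily distinct) independent sets $A_1,A_2$ and dependent sets $B_1,B_2$ with $\chi^{A_1}+\chi^{A_2}=\chi^{B_1}+\chi^{B_2}$, where $\chi^S\in\{0,1\}^V$ is the characteristic vector of $S$. A graph $G=(V,E)$ is threshold if there exist $w:V\to\mathbb{Z}_{\ge0}$ and $t\in\mathbb{Z}_{\ge0}$ such that for every $X\subseteq V$, $\sum_{x\in X}w(x)\le t$ if and only if $X$ is an independent set of $G$. The clique hypergraph $\mathcal{C}(G)$ has vertex set $V(G)$ and as hyperedges exactly the inclusion-maximal cliques of $G$. *)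

theory Defs
  imports "HOL-Library.Ramsey" "HOL-Library.Indicator_Function"
begin

text \<open>
  Graphs and hypergraphs are given by a vertex set \<open>V\<close> and a set \<open>E\<close> of (hyper)edges.
  The constants \<^const>\<open>clique\<close> and \<^const>\<open>indep\<close> of the Ramsey theory take the vertex
  subset in question as their first argument and the edge set as their second one.
  The empty graph is allowed; its only maximal clique is the empty set.
\<close>

definition simple_graph :: "'a set \<Rightarrow> 'a set set \<Rightarrow> bool" where
  "simple_graph V E \<longleftrightarrow> finite V \<and> E \<subseteq> [V]\<^bsup>2\<^esup>"

definition threshold_graph :: "'a set \<Rightarrow> 'a set set \<Rightarrow> bool" where
  "threshold_graph V E \<longleftrightarrow>
     (\<exists>(w :: 'a \<Rightarrow> nat) (t :: nat). \<forall>X\<subseteq>V. (\<Sum>x\<in>X. w x) \<le> t \<longleftrightarrow> indep X E)"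

definition hypergraph :: "'a set \<Rightarrow> 'a set set \<Rightarrow> bool" where
  "hypergraph V E \<longleftrightarrow> finite V \<and> E \<subseteq> Pow V"

definition hyper_dependent :: "'a set \<Rightarrow> 'a set set \<Rightarrow> 'a set \<Rightarrow> bool" where
  "hyper_dependent V E X \<longleftrightarrow> X \<subseteq> V \<and> (\<exists>e\<in>E. e \<subseteq> X)"

definition hyper_independent :: "'a set \<Rightarrow> 'a set set \<Rightarrow> 'a set \<Rightarrow> bool" where
  "hyper_independent V E X \<longleftrightarrow> X \<subseteq> V \<and> \<not> (\<exists>e\<in>E. e \<subseteq> X)"

definition one_Sperner :: "'a set set \<Rightarrow> bool" where
  "one_Sperner E \<longleftrightarrow> (\<forall>e\<in>E. \<forall>f\<in>E. e \<noteq> f \<longrightarrow> min (card (e - f)) (card (f - e)) = 1)"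

definition threshold_hypergraph :: "'a set \<Rightarrow> 'a set set \<Rightarrow> bool" where
  "threshold_hypergraph V E \<longleftrightarrow>
     (\<exists>(w :: 'a \<Rightarrow> nat) (t :: nat). \<forall>X\<subseteq>V. (\<Sum>x\<in>X. w x) \<ge> t \<longleftrightarrow> (\<exists>e\<in>E. e \<subseteq> X))"

definition two_asummable :: "'a set \<Rightarrow> 'a set set \<Rightarrow> bool" where
  "two_asummable V E \<longleftrightarrow>
     \<not> (\<exists>A\<^sub>1 A\<^sub>2 B\<^sub>1 B\<^sub>2.
          hyper_independent V E A\<^sub>1 \<and> hyper_independent V E A\<^sub>2 \<and>
          hyper_dependent V E B\<^sub>1 \<and> hyper_dependent V E B\<^sub>2 \<and>
          (\<forall>v\<in>V. (indicator A\<^sub>1 v + indicator A\<^sub>2 v :: nat) = indicator B\<^sub>1 v + indicator B\<^sub>2 v))"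

text \<open>The clique hypergraph of the graph \<open>(V, E)\<close> is \<open>(V, clique_hyperedges V E)\<close>.\<close>

definition clique_hyperedges :: "'a set \<Rightarrow> 'a set set \<Rightarrow> 'a set set" where
  "clique_hyperedges V E =
     {C. C \<subseteq> V \<and> clique C E \<and> (\<forall>D. D \<subseteq> V \<and> clique D E \<and> C \<subseteq> D \<longrightarrow> D = C)}"

lemma hypergraph_clique_hyperedges:
  "simple_graph V E \<Longrightarrow> hypergraph V (clique_hyperedges V E)"
  by (auto simp: simple_graph_def hypergraph_def clique_hyperedges_def)

end

theory Submission
  imports Defs
begin

text \<open>
  All four conditions are equivalent to the absence of an alternating 4-cycle, that is, of edges
  \<open>ab\<close>, \<open>cd\<close> and non-edges \<open>ac\<close>, \<open>bd\<close>. A finite graph without one has a dominating vertex or an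
  isolated vertex, so weights for the graph and for its clique hypergraph arise by adding such
  vertices one at a time. A threshold hypergraph is 2-asummable by adding up weights. If two maximal
  cliques \<open>B\<close>, \<open>C\<close> violate the 1-Sperner property, then exchanging some \<open>p \<in> B - C\<close> with
  some \<open>q \<in> C - B\<close> (adjacent to \<open>p\<close> whenever possible) violates 2-asummability. Finally, extending
  the two edges of an alternating 4-cycle to maximal cliques violates the 1-Sperner property.
\<close>

section \<open>Alternating 4-cycles and vertices of extreme degree\<close>

text \<open>If \<open>a = d\<close> or \<open>b = c\<close>, then \<open>{a, c}\<close> is itself
  one of the two given edges, so the condition holds. Hence in a loop-free graph only four distinct
  vertices can violate it.\<close>

definition alternating_free :: "'a set \<Rightarrow> 'a set set \<Rightarrow> bool" where
  "alternating_free V E \<longleftrightarrow>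
     (\<forall>a\<in>V. \<forall>b\<in>V. \<forall>c\<in>V. \<forall>d\<in>V. {a, b} \<in> E \<longrightarrow> {c, d} \<in> E \<longrightarrow> a \<noteq> c \<longrightarrow> b \<noteq> d \<longrightarrow>
        {a, c} \<in> E \<or> {b, d} \<in> E)"

lemma alternating_freeD:
  assumes "alternating_free V E" "a \<in> V" "b \<in> V" "c \<in> V" "d \<in> V"
    "{a, b} \<in> E" "{c, d} \<in> E" "a \<noteq> c" "b \<noteq> d" "{a, c} \<notin> E"
  shows "{b, d} \<in> E"
  using assms unfolding alternating_free_def by blast

lemma alternating_free_mono: "alternating_free V E \<Longrightarrow> W \<subseteq> V \<Longrightarrow> alternating_free W E"
  unfolding alternating_free_def by blast

text \<open>Take \<open>v\<close> of maximum degree. If it is not dominating, each non-neighbour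
  \<open>u\<close> of \<open>v\<close> is isolated: a neighbour \<open>x\<close> of \<open>u\<close>
  would be adjacent to all other neighbours of \<open>v\<close> and also to \<open>u\<close>, so its
  degree would exceed that of \<open>v\<close>.\<close>

lemma alternating_free_isolated_or_dominating:
  assumes "finite V" "V \<noteq> {}" and loopfree: "\<And>v. {v} \<notin> E" and af: "alternating_free V E"
  obtains v where "v \<in> V" "(\<forall>x\<in>V - {v}. {v, x} \<in> E) \<or> (\<forall>x\<in>V - {v}. {v, x} \<notin> E)"
proof -
  define N where "N = (\<lambda>v. {x \<in> V. {v, x} \<in> E})"
  have finN: "finite (N x)" for x
    using \<open>finite V\<close> by (auto simp: N_def)
  have "Max ((\<lambda>v. card (N v)) ` V) \<in> (\<lambda>v. card (N v)) ` V"
    using assms(1,2) by (intro Max_in) auto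
  then obtain v where v: "v \<in> V" "card (N v) = Max ((\<lambda>v. card (N v)) ` V)"
    by auto
  have vmax: "card (N x) \<le> card (N v)" if "x \<in> V" for x
    using that v(2) \<open>finite V\<close> by simp
  show thesis
  proof (cases "\<forall>x\<in>V - {v}. {v, x} \<in> E")
    case True
    then show thesis using that v(1) by blast
  next
    case False
    then obtain u where u: "u \<in> V" "u \<noteq> v" "{v, u} \<notin> E" by blast
    have "{u, x} \<notin> E" if x: "x \<in> V" for x
    proof
      assume ux: "{u, x} \<in> E"
      have "x \<noteq> v" using ux u by (auto simp: insert_commute)
      \<comment> \<open>Otherwise \<open>{v, y}\<close> and \<open>{u, x}\<close> are edges while
        \<open>{v, u}\<close> and \<open>{y, x}\<close> are not.\<close>
      have nb: "{x, y} \<in> E" if "y \<in> N v" "y \<noteq> x" for y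
        using alternating_freeD[OF af v(1), of y u x] that u ux x
        by (auto simp: N_def insert_commute)
      have uN: "u \<in> N x" "u \<notin> N v"
        using u ux by (auto simp: N_def insert_commute)
      show False
      proof (cases "x \<in> N v")
        case True
        \<comment> \<open>Here \<open>x\<close> is lost as its own neighbour, but \<open>v\<close>
          makes up for it, so \<open>u\<close> is still one neighbour more than \<open>v\<close>
          has.\<close>
        have "insert u (insert v (N v - {x})) \<subseteq> N x"
          using nb uN True v(1) by (auto simp: N_def insert_commute)
        then have "card (insert u (insert v (N v - {x}))) \<le> card (N x)"
          using finN by (intro card_mono)
        moreover have "v \<notin> N v" using loopfree by (simp add: N_def)
        ultimately show False
          using vmax[OF x] finN uN(2) u(2) True by (simp add: card_Suc_Diff1)
      next
        case False
        have "insert u (N v) \<subseteq> N x"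
          using nb uN False by (auto simp: N_def)
        then have "card (insert u (N v)) \<le> card (N x)"
          using finN by (intro card_mono)
        then show False
          using vmax[OF x] finN uN(2) by simp
      qed
    qed
    then show thesis using that[of u] u(1) by blast
  qed
qed

section \<open>Maximal cliques, and how they change when a vertex is added\<close>

lemma clique_insert_iff:
  "clique (insert v C) E \<longleftrightarrow> clique C E \<and> (\<forall>x\<in>C - {v}. {v, x} \<in> E)"
  by (auto simp: clique_def insert_commute)

lemma clique_subset: "clique C E \<Longrightarrow> D \<subseteq> C \<Longrightarrow> clique D E"
  by (auto simp: clique_def)

lemma clique_hyperedgesI:
  assumes "C \<subseteq> V" "clique C E" "\<And>D. D \<subseteq> V \<Longrightarrow> clique D E \<Longrightarrow> C \<subseteq> D \<Longrightarrow> D = C"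
  shows "C \<in> clique_hyperedges V E"
  using assms by (simp add: clique_hyperedges_def)

lemma clique_hyperedgesD:
  assumes "C \<in> clique_hyperedges V E"
  shows "C \<subseteq> V" "clique C E" "\<And>D. D \<subseteq> V \<Longrightarrow> clique D E \<Longrightarrow> C \<subseteq> D \<Longrightarrow> D = C"
  using assms by (simp_all add: clique_hyperedges_def)

lemma clique_hyperedges_subset_eq:
  assumes "B \<in> clique_hyperedges V E" "C \<in> clique_hyperedges V E" "B \<subseteq> C"
  shows "B = C"
  using assms clique_hyperedgesD by metis

lemma clique_hyperedges_mem:
  assumes C: "C \<in> clique_hyperedges V E" and v: "v \<in> V"
    and adj: "\<And>x. x \<in> C \<Longrightarrow> x \<noteq> v \<Longrightarrow> {v, x} \<in> E"
  shows "v \<in> C"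
proof -
  have "clique (insert v C) E"
    using clique_hyperedgesD(2)[OF C] adj by (simp add: clique_insert_iff)
  then have "insert v C = C"
    using clique_hyperedgesD(1)[OF C] v by (intro clique_hyperedgesD(3)[OF C]) auto
  then show ?thesis by blast
qed

lemma clique_extend:
  assumes "finite V" "C \<subseteq> V" "clique C E"
  obtains D where "D \<in> clique_hyperedges V E" "C \<subseteq> D"
proof -
  let ?S = "{D. D \<subseteq> V \<and> clique D E}"
  have "finite ?S" using assms(1) by simp
  moreover have "C \<in> ?S" using assms by simp
  ultimately obtain D where D: "D \<in> ?S" "C \<subseteq> D" "\<forall>D'\<in>?S. D \<subseteq> D' \<longrightarrow> D = D'"
    using finite_has_maximal2[of ?S C] by blast
  have "D \<in> clique_hyperedges V E"
    using D by (intro clique_hyperedgesI) auto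
  then show thesis using that D(2) by blast
qed

text \<open>Any clique stays a clique when \<open>v\<close> is added, so every maximal clique of the
  larger graph contains \<open>v\<close>. Removing \<open>v\<close> and inserting \<open>v\<close>
  are then mutually inverse and preserve maximality.\<close>

lemma clique_hyperedges_dominating:
  assumes v: "v \<notin> V" and dom: "\<And>x. x \<in> V \<Longrightarrow> {v, x} \<in> E"
  shows "clique_hyperedges (insert v V) E = insert v ` clique_hyperedges V E"
proof (intro equalityI subsetI)
  fix C assume C: "C \<in> clique_hyperedges (insert v V) E"
  note CD = clique_hyperedgesD[OF C]
  have vC: "v \<in> C"
    by (rule clique_hyperedges_mem[OF C]) (use CD(1) dom in auto)
  have "C - {v} \<in> clique_hyperedges V E"
  proof (rule clique_hyperedgesI)
    show "C - {v} \<subseteq> V" using CD(1) by auto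
    show "clique (C - {v}) E" using CD(2) by (rule clique_subset) auto
    fix D assume D: "D \<subseteq> V" "clique D E" "C - {v} \<subseteq> D"
    then have "clique (insert v D) E" using dom by (auto simp: clique_insert_iff)
    then have "insert v D = C" using D by (intro CD(3)) auto
    then show "D = C - {v}" using D(1) v by auto
  qed
  moreover have "C = insert v (C - {v})" using vC by auto
  ultimately show "C \<in> insert v ` clique_hyperedges V E" by (rule rev_image_eqI)
next
  fix C' assume "C' \<in> insert v ` clique_hyperedges V E"
  then obtain C where C: "C \<in> clique_hyperedges V E" and C': "C' = insert v C" by auto
  note CD = clique_hyperedgesD[OF C]
  show "C' \<in> clique_hyperedges (insert v V) E"
  proof (rule clique_hyperedgesI)
    show "C' \<subseteq> insert v V" using CD(1) C' by auto
    show "clique C' E" using CD(1,2) C' dom by (auto simp: clique_insert_iff)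
    fix D assume D: "D \<subseteq> insert v V" "clique D E" "C' \<subseteq> D"
    have "D - {v} = C"
    proof (rule CD(3))
      show "D - {v} \<subseteq> V" using D(1) by auto
      show "clique (D - {v}) E" using D(2) by (rule clique_subset) auto
      show "C \<subseteq> D - {v}" using CD(1) v D(3) C' by auto
    qed
    then show "D = C'" using D C' by auto
  qed
qed

text \<open>The only clique through \<open>v\<close> is \<open>{v}\<close>, so the other maximal
  cliques are untouched. For empty \<open>V\<close> this would fail: \<open>{}\<close> is maximal
  there, but no longer after \<open>v\<close> is added.\<close>

lemma clique_hyperedges_isolated:
  assumes v: "v \<notin> V" and "V \<noteq> {}" and iso: "\<And>x. x \<in> V \<Longrightarrow> {v, x} \<notin> E"
  shows "clique_hyperedges (insert v V) E = insert {v} (clique_hyperedges V E)"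
proof -
  have cl: "D \<subseteq> V \<or> D = {v}" if "D \<subseteq> insert v V" "clique D E" for D
  proof (cases "v \<in> D")
    case True
    then have "{v, x} \<in> E" if "x \<in> D" "x \<noteq> v" for x
      using \<open>clique D E\<close> that by (simp add: clique_def)
    then show ?thesis using iso \<open>D \<subseteq> insert v V\<close> True by blast
  qed (use that in blast)
  have empty: "{} \<notin> clique_hyperedges V E"
    using clique_hyperedges_mem[of "{}" V E] \<open>V \<noteq> {}\<close> by auto
  show ?thesis
  proof (intro equalityI subsetI)
    fix C assume C: "C \<in> clique_hyperedges (insert v V) E"
    note CD = clique_hyperedgesD[OF C]
    have "C \<in> clique_hyperedges V E" if "C \<noteq> {v}"
      using cl[OF CD(1,2)] that CD by (intro clique_hyperedgesI) auto
    then show "C \<in> insert {v} (clique_hyperedges V E)" by blast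
  next
    fix C assume "C \<in> insert {v} (clique_hyperedges V E)"
    then consider "C = {v}" | "C \<in> clique_hyperedges V E" by blast
    then show "C \<in> clique_hyperedges (insert v V) E"
    proof cases
      case 1
      show ?thesis
      proof (rule clique_hyperedgesI)
        show "C \<subseteq> insert v V" "clique C E" using 1 by (auto simp: clique_def)
        show "D = C" if "D \<subseteq> insert v V" "clique D E" "C \<subseteq> D" for D
          using cl[OF that(1,2)] that(3) 1 v by auto
      qed
    next
      case 2
      note CD = clique_hyperedgesD[OF 2]
      show ?thesis
      proof (rule clique_hyperedgesI)
        show "C \<subseteq> insert v V" "clique C E" using CD by auto
        show "D = C" if D: "D \<subseteq> insert v V" "clique D E" "C \<subseteq> D" for D
          using cl[OF D(1,2)]
        proof
          assume "D \<subseteq> V"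
          then show ?thesis using D by (intro CD(3))
        next
          assume "D = {v}"
          then have "C = {}" using D(3) CD(1) v by auto
          then show ?thesis using 2 empty by simp
        qed
      qed
    qed
  qed
qed

section \<open>Weights built up vertex by vertex\<close>

text \<open>
  Positive weights and a positive bound are demanded because a dominating vertex gets weight \<open>t\<close>:
  it must be within the bound alone, but exceed it together with any other vertex.
\<close>

lemma alternating_free_positive_weights:
  assumes "finite V" and loopfree: "\<And>v. {v} \<notin> E" and "alternating_free V E"
  shows "\<exists>(w :: 'a \<Rightarrow> nat) (t :: nat). 0 < t \<and> (\<forall>x\<in>V. 0 < w x) \<and>
           (\<forall>X\<subseteq>V. (\<Sum>x\<in>X. w x) \<le> t \<longleftrightarrow> indep X E)"
  using assms(1,3)
\<comment> \<open>\<open>E\<close> stays fixed while \<open>V\<close> shrinks, so edges may leave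
  the current \<open>V\<close>. The absence of loops survives this, whereas
  \<open>simple_graph V E\<close> would not.\<close>
proof (induction V rule: finite_psubset_induct)
  case (psubset V)
  show ?case
  proof (cases "V = {}")
    case True
    then show ?thesis by (auto simp: indep_def intro!: exI[of _ 1])
  next
    case False
    from alternating_free_isolated_or_dominating[OF psubset.hyps False loopfree psubset.prems]
    obtain v where v: "v \<in> V"
      and cases: "(\<forall>x\<in>V - {v}. {v, x} \<in> E) \<or> (\<forall>x\<in>V - {v}. {v, x} \<notin> E)" by blast
    define U where "U = V - {v}"
    have U: "V = insert v U" "v \<notin> U" "finite U" using v psubset.hyps by (auto simp: U_def)
    have "U \<subset> V" using U by auto
    then obtain w t where t: "0 < t" and pos: "\<And>x. x \<in> U \<Longrightarrow> (0::nat) < w x"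
      and wt: "\<And>X. X \<subseteq> U \<Longrightarrow> sum w X \<le> t \<longleftrightarrow> indep X E"
      using psubset.IH[of U] alternating_free_mono[OF psubset.prems, of U] by auto
    from cases show ?thesis
    proof
      assume dom: "\<forall>x\<in>V - {v}. {v, x} \<in> E"
      have "sum (w(v := t)) X \<le> t \<longleftrightarrow> indep X E" if X: "X \<subseteq> V" for X
      proof (cases "v \<in> X")
        case True
        define Y where "Y = X - {v}"
        have Y: "X = insert v Y" "Y \<subseteq> U" and vY: "v \<notin> Y"
          using True X U by (auto simp: Y_def)
        have fY: "finite Y" using Y(2) U(3) finite_subset by auto
        have "sum (w(v := t)) Y = sum w Y" using vY by (intro sum.cong) auto
        then have "sum (w(v := t)) X = t + sum w Y"
          unfolding Y(1) using vY fY by simp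
        moreover have "sum w Y = 0 \<longleftrightarrow> Y = {}"
          using fY pos Y(2) by (fastforce simp: subset_iff)
        moreover have "indep X E \<longleftrightarrow> Y = {}"
          using dom Y vY U by (auto simp: indep_def)
        ultimately show ?thesis by simp
      next
        case False
        then have "sum (w(v := t)) X = sum w X" by (intro sum.cong) auto
        then show ?thesis using wt[of X] X U(1) False by auto
      qed
      then show ?thesis
        using t pos U by (intro exI[of _ "w(v := t)"] exI[of _ t]) auto
    next
      assume iso: "\<forall>x\<in>V - {v}. {v, x} \<notin> E"
      \<comment> \<open>Doubling leaves room for a positive weight of the isolated vertex: for a
        weight \<open>s\<close> of the remaining vertices, both \<open>2 * s\<close> and
        \<open>2 * s + 1\<close> are at most \<open>2 * t + 1\<close> exactly if \<open>s\<close> is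
        at most \<open>t\<close>.\<close>
      define w' where "w' = (\<lambda>x. if x = v then 1 else 2 * w x)"
      have "sum w' X \<le> 2 * t + 1 \<longleftrightarrow> indep X E" if X: "X \<subseteq> V" for X
      proof -
        have sY: "sum w' (X - {v}) = 2 * sum w (X - {v})"
          unfolding sum_distrib_left by (intro sum.cong) (auto simp: w'_def)
        have "finite X" using X psubset.hyps finite_subset by auto
        then have "sum w' X = (if v \<in> X then 1 else 0) + 2 * sum w (X - {v})"
          unfolding sY[symmetric] by (cases "v \<in> X") (auto simp: sum.remove[of X v] w'_def)
        moreover have "sum w (X - {v}) \<le> t \<longleftrightarrow> indep (X - {v}) E"
          using X U by (intro wt) auto
        moreover have "indep (X - {v}) E \<longleftrightarrow> indep X E"
          using iso X by (fastforce simp: indep_def insert_commute)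
        ultimately show ?thesis by auto
      qed
      then show ?thesis
        using pos U(1) by (intro exI[of _ w'] exI[of _ "2 * t + 1"]) (auto simp: w'_def)
    qed
  qed
qed

text \<open>A dominating vertex lies in every hyperedge, so it gets a weight without which the
  raised threshold is out of reach. An isolated vertex is a hyperedge alone, so its weight is the
  unchanged threshold.\<close>

lemma alternating_free_imp_threshold_hypergraph:
  assumes "finite V" and loopfree: "\<And>v. {v} \<notin> E" and "alternating_free V E"
  shows "threshold_hypergraph V (clique_hyperedges V E)"
  using assms(1,3)
proof (induction V rule: finite_psubset_induct)
  case (psubset V)
  show ?case
  proof (cases "V = {}")
    case True
    \<comment> \<open>The empty clique is a hyperedge contained in the empty set, so the threshold
      is 0.\<close>
    then show ?thesis
      by (auto simp: threshold_hypergraph_def clique_hyperedges_def clique_def intro!: exI[of _ 0])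
  next
    case False
    from alternating_free_isolated_or_dominating[OF psubset.hyps False loopfree psubset.prems]
    obtain v where v: "v \<in> V"
      and cases: "(\<forall>x\<in>V - {v}. {v, x} \<in> E) \<or> (\<forall>x\<in>V - {v}. {v, x} \<notin> E)" by blast
    define U where "U = V - {v}"
    have U: "V = insert v U" "v \<notin> U" "finite U" using v psubset.hyps by (auto simp: U_def)
    have "U \<subset> V" using U by auto
    then obtain w t where wt: "\<And>X. X \<subseteq> U \<Longrightarrow> (t::nat) \<le> sum w X \<longleftrightarrow> (\<exists>e\<in>clique_hyperedges U E. e \<subseteq> X)"
      using psubset.IH[of U] alternating_free_mono[OF psubset.prems, of U]
      by (auto simp: threshold_hypergraph_def)
    have sumX: "sum (w(v := s)) X = (if v \<in> X then s else 0) + sum w (X - {v})"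
      if "X \<subseteq> V" for X and s :: nat
    proof -
      have "sum (w(v := s)) (X - {v}) = sum w (X - {v})" by (intro sum.cong) auto
      moreover have "finite X" using that psubset.hyps finite_subset by auto
      ultimately show ?thesis by (cases "v \<in> X") (auto simp: sum.remove[of X v])
    qed
    have inU: "X - {v} \<subseteq> U" if "X \<subseteq> V" for X using that U by auto
    have vn: "v \<notin> e" if "e \<in> clique_hyperedges U E" for e
      using that U(2) by (auto simp: clique_hyperedges_def)
    \<comment> \<open>A single vertex is both dominating and isolated. It is treated as dominating,
      because the description of the maximal cliques in the isolated case needs \<open>U\<close>
      nonempty.\<close>
    consider "\<forall>x\<in>U. {v, x} \<in> E" | "\<forall>x\<in>U. {v, x} \<notin> E" "U \<noteq> {}"
      using cases U_def by auto
    then show ?thesis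
    proof cases
      case 1
      then have CH: "clique_hyperedges V E = insert v ` clique_hyperedges U E"
        using clique_hyperedges_dominating[of v U E] U by auto
      \<comment> \<open>The summand 1 makes the threshold exceed \<open>sum w U\<close> even for
        \<open>t = 0\<close>, so that sets avoiding \<open>v\<close> always fall short.\<close>
      have "sum w U + 1 + t \<le> sum (w(v := sum w U + 1)) X \<longleftrightarrow> (\<exists>e\<in>clique_hyperedges V E. e \<subseteq> X)"
        if X: "X \<subseteq> V" for X
      proof -
        have "sum w (X - {v}) \<le> sum w U" using inU[OF X] U(3) by (intro sum_mono2) auto
        moreover have "insert v e \<subseteq> X \<longleftrightarrow> v \<in> X \<and> e \<subseteq> X - {v}" if "e \<in> clique_hyperedges U E" for e
          using vn[OF that] by auto
        then have "(\<exists>e\<in>clique_hyperedges V E. e \<subseteq> X) \<longleftrightarrow>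
            v \<in> X \<and> (\<exists>e\<in>clique_hyperedges U E. e \<subseteq> X - {v})"
          unfolding CH by (simp cong: bex_cong)
        ultimately show ?thesis
          unfolding sumX[OF X] using wt[OF inU[OF X]] by auto
      qed
      then show ?thesis unfolding threshold_hypergraph_def by blast
    next
      case 2
      then have CH: "clique_hyperedges V E = insert {v} (clique_hyperedges U E)"
        using clique_hyperedges_isolated[of v U E] U by auto
      have "t \<le> sum (w(v := t)) X \<longleftrightarrow> (\<exists>e\<in>clique_hyperedges V E. e \<subseteq> X)"
        if X: "X \<subseteq> V" for X
      proof -
        have "e \<subseteq> X \<longleftrightarrow> e \<subseteq> X - {v}" if "e \<in> clique_hyperedges U E" for e
          using vn[OF that] by auto
        then have "(\<exists>e\<in>clique_hyperedges V E. e \<subseteq> X) \<longleftrightarrow>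
            v \<in> X \<or> (\<exists>e\<in>clique_hyperedges U E. e \<subseteq> X - {v})"
          unfolding CH by (simp cong: bex_cong)
        then show ?thesis
          unfolding sumX[OF X] using wt[OF inU[OF X]] by auto
      qed
      then show ?thesis unfolding threshold_hypergraph_def by blast
    qed
  qed
qed

section \<open>Conditions that exclude alternating 4-cycles\<close>

text \<open>The four weights of an alternating 4-cycle would sum to more than \<open>2 * t\<close>
  when paired along the edges, and to at most \<open>2 * t\<close> when paired along the
  non-edges.\<close>

lemma threshold_graph_imp_alternating_free:
  assumes loopfree: "\<And>v. {v} \<notin> E" and "threshold_graph V E"
  shows "alternating_free V E"
  unfolding alternating_free_def
proof (intro ballI impI, rule ccontr)
  fix a b c d
  assume V: "a \<in> V" "b \<in> V" "c \<in> V" "d \<in> V"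
    and edges: "{a, b} \<in> E" "{c, d} \<in> E" and "a \<noteq> c" "b \<noteq> d"
    and nonedges: "\<not> ({a, c} \<in> E \<or> {b, d} \<in> E)"
  obtain w and t :: nat where wt: "\<And>X. X \<subseteq> V \<Longrightarrow> sum w X \<le> t \<longleftrightarrow> indep X E"
    using assms(2) unfolding threshold_graph_def by auto
  have "a \<noteq> b" "c \<noteq> d" using edges loopfree by auto
  then have "\<not> w a + w b \<le> t" "\<not> w c + w d \<le> t"
    using wt[of "{a, b}"] wt[of "{c, d}"] edges V by (auto simp: indep_def)
  moreover have "w a + w c \<le> t" "w b + w d \<le> t"
    using wt[of "{a, c}"] wt[of "{b, d}"] nonedges V \<open>a \<noteq> c\<close> \<open>b \<noteq> d\<close>
    by (auto simp: indep_def insert_commute)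
  ultimately show False by linarith
qed

lemma one_Sperner_imp_alternating_free:
  assumes "finite V" and loopfree: "\<And>v. {v} \<notin> E" and sperner: "one_Sperner (clique_hyperedges V E)"
  shows "alternating_free V E"
  unfolding alternating_free_def
proof (intro ballI impI, rule ccontr)
  fix a b c d
  assume V: "a \<in> V" "b \<in> V" "c \<in> V" "d \<in> V"
    and edges: "{a, b} \<in> E" "{c, d} \<in> E" and "a \<noteq> c" "b \<noteq> d"
    and nonedges: "\<not> ({a, c} \<in> E \<or> {b, d} \<in> E)"
  have "a \<noteq> b" "c \<noteq> d" using edges loopfree by auto
  obtain B where B: "B \<in> clique_hyperedges V E" "{a, b} \<subseteq> B"
    using clique_extend[OF assms(1), of "{a, b}" E] V edges by (auto simp: clique_def insert_commute)
  obtain C where C: "C \<in> clique_hyperedges V E" "{c, d} \<subseteq> C"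
    using clique_extend[OF assms(1), of "{c, d}" E] V edges by (auto simp: clique_def insert_commute)
  have "clique B E" "clique C E" and fin: "finite B" "finite C"
    using B C assms(1) by (auto simp: clique_hyperedges_def intro: finite_subset)
  \<comment> \<open>The non-edge \<open>{a, c}\<close> keeps \<open>a\<close> out of
    \<open>C\<close> and \<open>c\<close> out of \<open>B\<close>; the non-edge
    \<open>{b, d}\<close> does the same for \<open>b\<close> and \<open>d\<close>.\<close>
  then have sub: "{a, b} \<subseteq> B - C" "{c, d} \<subseteq> C - B"
    using B(2) C(2) nonedges \<open>a \<noteq> c\<close> \<open>b \<noteq> d\<close> unfolding clique_def
    by (auto simp: insert_commute)
  have "card {a, b} \<le> card (B - C)" "card {c, d} \<le> card (C - B)"
    using sub fin by (auto intro!: card_mono simp del: card_insert_disjoint)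
  then have "min (card (B - C)) (card (C - B)) \<noteq> 1"
    using \<open>a \<noteq> b\<close> \<open>c \<noteq> d\<close> by simp
  then show False
    using sperner B(1) C(1) sub unfolding one_Sperner_def by blast
qed

section \<open>2-asummability and exchanges between maximal cliques\<close>

lemma threshold_hypergraph_imp_two_asummable:
  assumes "finite V" "threshold_hypergraph V H"
  shows "two_asummable V H"
  unfolding two_asummable_def
proof (rule notI, elim exE conjE)
  fix A\<^sub>1 A\<^sub>2 B\<^sub>1 B\<^sub>2
  assume indep: "hyper_independent V H A\<^sub>1" "hyper_independent V H A\<^sub>2"
    and dep: "hyper_dependent V H B\<^sub>1" "hyper_dependent V H B\<^sub>2"
    and eq: "\<forall>v\<in>V. (indicator A\<^sub>1 v + indicator A\<^sub>2 v :: nat) = indicator B\<^sub>1 v + indicator B\<^sub>2 v"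
  obtain w and t :: nat where wt: "\<And>X. X \<subseteq> V \<Longrightarrow> t \<le> sum w X \<longleftrightarrow> (\<exists>e\<in>H. e \<subseteq> X)"
    using assms(2) unfolding threshold_hypergraph_def by auto
  \<comment> \<open>Written as sums over all of \<open>V\<close>, the weights can be compared by
    multiplying the equation \<open>eq\<close> pointwise with \<open>w\<close>.\<close>
  have sum_ind: "sum w X = (\<Sum>v\<in>V. indicator X v * w v)" if "X \<subseteq> V" for X
    using sum.inter_restrict[OF assms(1), of w X] that
    by (simp add: Int_absorb1 indicator_def of_bool_def if_distribR if_distrib[of "\<lambda>x. x * _"] cong: if_cong)
  have "sum w A\<^sub>1 < t" "sum w A\<^sub>2 < t"
    using indep wt[of A\<^sub>1] wt[of A\<^sub>2] by (auto simp: hyper_independent_def)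
  moreover have "t \<le> sum w B\<^sub>1" "t \<le> sum w B\<^sub>2"
    using dep wt[of B\<^sub>1] wt[of B\<^sub>2] by (auto simp: hyper_dependent_def)
  moreover have "sum w A\<^sub>1 + sum w A\<^sub>2 = sum w B\<^sub>1 + sum w B\<^sub>2"
    using indep dep eq unfolding hyper_independent_def hyper_dependent_def
    by (simp add: sum_ind sum.distrib[symmetric] distrib_right[symmetric])
  ultimately show False by linarith
qed

text \<open>A maximal clique \<open>D\<close> inside the new set must contain \<open>q\<close>,
  since it would otherwise be properly contained in \<open>B\<close>. If \<open>p\<close> is
  adjacent to \<open>q\<close>, it is adjacent to all of \<open>D\<close>, contradicting maximality.
  If \<open>q\<close> has no neighbour in \<open>B - C\<close>, then \<open>D\<close> lies in
  \<open>C\<close> and thus equals \<open>C\<close>.\<close>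

lemma clique_hyperedges_exchange_independent:
  assumes B: "B \<in> clique_hyperedges V E" and C: "C \<in> clique_hyperedges V E"
    and p: "p \<in> B" "p \<notin> C" and q: "q \<in> C" "q \<notin> B"
    and adj: "{p, q} \<in> E \<or> ((\<forall>x\<in>B - C. {x, q} \<notin> E) \<and> C - B \<noteq> {q})"
  shows "hyper_independent V (clique_hyperedges V E) (insert q (B - {p}))"
proof -
  have BC: "B \<subseteq> V" "clique B E" "C \<subseteq> V"
    using B C by (auto simp: clique_hyperedges_def)
  have False if D: "D \<in> clique_hyperedges V E" "D \<subseteq> insert q (B - {p})" for D
  proof (cases "q \<in> D")
    case False
    then show False
      using clique_hyperedges_subset_eq[OF D(1) B] D(2) p(1) by auto
  next
    case qD: True
    have cD: "clique D E" using D(1) by (simp add: clique_hyperedges_def)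
    from adj show False
    proof
      assume "{p, q} \<in> E"
      then have "p \<in> D"
        using D(2) BC p(1) unfolding clique_def
        by (intro clique_hyperedges_mem[OF D(1)]) auto
      then show False using D(2) p q by auto
    next
      assume nc: "(\<forall>x\<in>B - C. {x, q} \<notin> E) \<and> C - B \<noteq> {q}"
      have "{x, q} \<in> E" if "x \<in> D" "x \<noteq> q" for x
        using cD qD that by (simp add: clique_def)
      then have "D \<subseteq> C" using nc D(2) q(1) by blast
      then have "D = C" using clique_hyperedges_subset_eq[OF D(1) C] by auto
      \<comment> \<open>Now \<open>C\<close> lies in \<open>insert q (B - {p})\<close>, so
        \<open>q\<close> would be the only element of \<open>C - B\<close>.\<close>
      then show False using nc D(2) q by auto
    qed
  qed
  then show ?thesis
    using BC q by (auto simp: hyper_independent_def)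
qed

lemma two_asummable_imp_one_Sperner:
  assumes "finite V" and asum: "two_asummable V (clique_hyperedges V E)"
  shows "one_Sperner (clique_hyperedges V E)"
  unfolding one_Sperner_def
proof (intro ballI impI, rule ccontr)
  fix B C
  assume B: "B \<in> clique_hyperedges V E" and C: "C \<in> clique_hyperedges V E" and "B \<noteq> C"
    and not1: "min (card (B - C)) (card (C - B)) \<noteq> 1"
  have "B - C \<noteq> {}" "C - B \<noteq> {}"
    using clique_hyperedges_subset_eq B C \<open>B \<noteq> C\<close> by blast+
  moreover have "finite B" "finite C"
    using B C assms(1) by (auto simp: clique_hyperedges_def intro: finite_subset)
  ultimately have "card (B - C) \<noteq> 0" "card (C - B) \<noteq> 0" by auto
  then have "card (B - C) \<noteq> 1" "card (C - B) \<noteq> 1"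
    using not1 by linarith+
  then have nonsingle: "B - C \<noteq> {x}" "C - B \<noteq> {x}" for x
    by (metis is_singletonI is_singleton_altdef)+
  \<comment> \<open>Take an edge between \<open>B - C\<close> and \<open>C - B\<close> if there is
    one, and any pair otherwise. This condition is symmetric, so it serves both exchanges.\<close>
  obtain p q where p: "p \<in> B" "p \<notin> C" and q: "q \<in> C" "q \<notin> B"
    and adj: "{p, q} \<in> E \<or> (\<forall>x\<in>B - C. \<forall>y\<in>C - B. {x, y} \<notin> E)"
    using \<open>B - C \<noteq> {}\<close> \<open>C - B \<noteq> {}\<close> by blast
  have "hyper_independent V (clique_hyperedges V E) (insert q (B - {p}))"
    using clique_hyperedges_exchange_independent[OF B C p q] adj nonsingle q by blast
  moreover have "hyper_independent V (clique_hyperedges V E) (insert p (C - {q}))"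
    using clique_hyperedges_exchange_independent[OF C B q p] adj nonsingle p
    by (metis DiffI insert_commute)
  moreover have "hyper_dependent V (clique_hyperedges V E) B" "hyper_dependent V (clique_hyperedges V E) C"
    using B C by (auto simp: hyper_dependent_def clique_hyperedges_def)
  \<comment> \<open>The exchange only swaps the places of \<open>p\<close> and \<open>q\<close>,
    each of which is still covered once.\<close>
  moreover have "\<forall>v\<in>V. (indicator (insert q (B - {p})) v + indicator (insert p (C - {q})) v :: nat)
      = indicator B v + indicator C v"
    using p q by (auto simp: indicator_def)
  ultimately show False
    using asum unfolding two_asummable_def by blast
qed

theorem theorem3p3:
  fixes V :: "'a set" and E :: "'a set set"
  assumes "simple_graph V E"
  shows "(threshold_graph V E \<longleftrightarrow> one_Sperner (clique_hyperedges V E)) \<and>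
         (threshold_graph V E \<longleftrightarrow> threshold_hypergraph V (clique_hyperedges V E)) \<and>
         (threshold_graph V E \<longleftrightarrow> two_asummable V (clique_hyperedges V E))"
proof -
  have fin: "finite V" and loopfree: "\<And>v. {v} \<notin> E"
    using assms by (auto simp: simple_graph_def nsets_def)
  have "threshold_graph V E" if "alternating_free V E"
    using alternating_free_positive_weights[OF fin loopfree that] by (auto simp: threshold_graph_def)
  \<comment> \<open>The three hypergraph conditions form a cycle with
    \<open>alternating_free V E\<close>, which is equivalent to
    \<open>threshold_graph V E\<close>.\<close>
  then show ?thesis
    using threshold_graph_imp_alternating_free[OF loopfree, of V]
      alternating_free_imp_threshold_hypergraph[OF fin loopfree]
      threshold_hypergraph_imp_two_asummable[OF fin]
      two_asummable_imp_one_Sperner[OF fin]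
      one_Sperner_imp_alternating_free[OF fin loopfree]
    by blast
qed

end
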